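(* Let $n\ge 1$. The following bilinear maps $\varphi_{j,k}$ ($1\le j,k\le n$) and $\psi_{j,k}$ ($1\le j\le n$, $1\le k\le n$, $(j,k)\neq(n,1)$) on $NF^{n,n}$ (values on pairs of basis elements not listed being zero, and $y_{n+1}:=0$) form a basis of $ZL_0^2(NF^{n,n},NF^{n,n})$: - $\varphi_{1,1}$: $\varphi_{1,1}(y_1,y_1)=x_1$; $\varphi_{1,1}(x_i,x_1)=-x_{i+1}$ ($1\le i\le n-1$); $\varphi_{1,1}(y_i,x_1)=-y_{i+1}$ ($2\le i\le n-1$). - $\varphi_{j,1}$ ($2\le j\le n$): $\varphi_{j,1}(y_j,y_1)=x_1$; $\varphi_{j,1}(x_{j-1},x_1)=x_1$; $\varphi_{j,1}(y_j,x_1)=y_2$; $\varphi_{j,1}(x_i,x_j)=-x_{i+1}$ and $\varphi_{j,1}(y_i,x_j)=-y_{i+1}$ ($1\le i\le n-1$). - $\varphi_{1,k}$ ($2\le k\le n$): $\varphi_{1,k}(y_1,y_1)=x_k$; $\varphi_{1,k}(y_1,x_1)=y_{k+1}$. - $\varphi_{j,k}$ ($2\le j\le n$, $2\le k\le n$): $\varphi_{j,k}(y_j,y_1)=x_k$; $\varphi_{j,k}(x_{j-1},x_1)=x_k$; $\varphi_{j,k}(y_j,x_1)=y_{k+1}$. - $\psi_{j,1}$ ($1\le j\le n-1$): $\psi_{j,1}(x_j,y_1)=y_1$; $\psi_{j,1}(x_j,x_1)=2x_1$; $\psi_{j,1}(y_j,x_1)=2y_1$; $\psi_{j,1}(x_i,x_{j+1})=-2x_{i+1}$,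 $\psi_{j,1}(y_i,x_{j+1})=-2y_{i+1}$ and $\psi_{j,1}(x_i,y_{j+1})=-y_{i+1}$ ($1\le i\le n-1$); $\psi_{j,1}(y_i,y_{j+1})=-2x_i$ ($1\le i\le n$). - $\psi_{j,k}$ ($1\le j\le n$, $2\le k\le n$): $\psi_{j,k}(x_j,y_1)=y_k$; $\psi_{j,k}(x_j,x_1)=2x_k$; $\psi_{j,k}(y_j,x_1)=2y_k$.
   Context: $F$ is a field of characteristic zero. $NF^{n,n}$ is the Leibniz superalgebra with even basis $x_1,\dots,x_n$, odd basis $y_1,\dots,y_n$ and products $[y_i,y_1]=x_i$ ($1\le i\le n$), $[x_i,y_1]=\frac12y_{i+1}$, $[y_i,x_1]=y_{i+1}$, $[x_i,x_1]=x_{i+1}$ ($1\le i\le n-1$), all other products of basis elements being zero. For a Leibniz superalgebra $L=L_0\oplus L_1$ (a $\mathbb Z_2$-graded algebra with $[x,[y,z]]=[[x,y],z]-(-1)^{|y||z|}[[x,z],y]$), the space $ZL_0^2(L,L)$ of even 2-cocycles (infinitesimal deformations) consists of the bilinear maps $\varphi:L\times L\to L$ with $\varphi(L_a,L_b)\subseteq L_{a+b}$ such that for all homogeneous $x,y,z\in L$ $$[x,\varphi(y,z)]-[\varphi(x,y),z]+(-1)^{|y||z|}[\varphi(x,z),y]+\varphi(x,[y,z])-\varphi([x,y],z)+(-1)^{|y||z|}\varphi([x,z],y)=0.$$ *)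

theory Defs
  imports Complex_Main "HOL-Library.Z2" "HOL-Library.Function_Algebras"
begin

section \<open>Even 2-cocycles of a Leibniz superalgebra\<close>

text \<open>
  A superspace is given by its two homogeneous components \<^term>\<open>L 0\<close> and \<^term>\<open>L 1\<close>, which are
  subspaces of an ambient vector space; degrees live in the two-element field \<^typ>\<open>bit\<close>.
  Vectors and bilinear maps are both functions, so their additive structure is the pointwise one.
\<close>

definition superspace_total :: "(bit \<Rightarrow> 'v::ab_group_add set) \<Rightarrow> 'v set" where
  "superspace_total L = {u + v | u v. u \<in> L 0 \<and> v \<in> L 1}"

text \<open>The factor $(-1)^{|y||z|}$, acting on a vector, for degrees \<open>b\<close> of y and \<open>c\<close> of z.\<close>

definition koszul :: "bit \<Rightarrow> bit \<Rightarrow> 'v::ab_group_add \<Rightarrow> 'v" where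
  "koszul b c v = (if b * c = 1 then - v else v)"

definition bilinear_on ::
    "('a::field \<Rightarrow> 'v::ab_group_add \<Rightarrow> 'v) \<Rightarrow> 'v set \<Rightarrow> ('v \<Rightarrow> 'v \<Rightarrow> 'v) \<Rightarrow> bool" where
  "bilinear_on scale V f \<longleftrightarrow>
     (\<forall>u\<in>V. \<forall>v\<in>V. \<forall>w\<in>V. f (u + v) w = f u w + f v w \<and> f w (u + v) = f w u + f w v) \<and>
     (\<forall>c. \<forall>u\<in>V. \<forall>v\<in>V. f (scale c u) v = scale c (f u v) \<and> f u (scale c v) = scale c (f u v))"

text \<open>
  A bilinear map on the superspace is represented by the HOL function on the ambient type that
  agrees with it on \<^term>\<open>superspace_total L\<close> and is 0 as soon as one argument lies outside of
  \<^term>\<open>superspace_total L\<close>; so distinct functions in the set below are distinct bilinear maps.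
\<close>

definition even_2cocycles ::
    "('a::field \<Rightarrow> 'v::ab_group_add \<Rightarrow> 'v) \<Rightarrow> (bit \<Rightarrow> 'v set) \<Rightarrow> ('v \<Rightarrow> 'v \<Rightarrow> 'v) \<Rightarrow>
     ('v \<Rightarrow> 'v \<Rightarrow> 'v) set" where
  "even_2cocycles scale L br = {f.
     (\<forall>u v. u \<notin> superspace_total L \<or> v \<notin> superspace_total L \<longrightarrow> f u v = 0) \<and>
     bilinear_on scale (superspace_total L) f \<and>
     (\<forall>a b. \<forall>u\<in>L a. \<forall>v\<in>L b. f u v \<in> L (a + b)) \<and>
     (\<forall>a b c. \<forall>x\<in>L a. \<forall>y\<in>L b. \<forall>z\<in>L c.
        br x (f y z) - br (f x y) z + koszul b c (br (f x z) y)
        + f x (br y z) - f (br x y) z + koszul b c (f (br x z) y) = 0)}"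


section \<open>The superalgebra NF\<close>

text \<open>
  Elements of NF are coordinate functions supported on the generators with index
  in \<open>{1..n}\<close>.
\<close>

datatype gen = X nat | Y nat

fun parity :: "gen \<Rightarrow> bit" where
  "parity (X i) = 0"
| "parity (Y i) = 1"

definition gens :: "nat \<Rightarrow> gen set" where
  "gens n = X ` {1..n} \<union> Y ` {1..n}"

definition vscale :: "'a::field \<Rightarrow> (gen \<Rightarrow> 'a) \<Rightarrow> (gen \<Rightarrow> 'a)" where
  "vscale c v = (\<lambda>g. c * v g)"

definition NF :: "nat \<Rightarrow> bit \<Rightarrow> (gen \<Rightarrow> 'a::field) set" where
  "NF n a = {v. \<forall>g. v g \<noteq> 0 \<longrightarrow> g \<in> gens n \<and> parity g = a}"

text \<open>The basis vectors, with the convention that they vanish for an index outside \<open>{1..n}\<close>.\<close>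

definition basis_vec :: "nat \<Rightarrow> gen \<Rightarrow> (gen \<Rightarrow> 'a::field)" where
  "basis_vec n g = (\<lambda>h. if h = g \<and> g \<in> gens n then 1 else 0)"

abbreviation xb :: "nat \<Rightarrow> nat \<Rightarrow> (gen \<Rightarrow> 'a::field)" where
  "xb n i \<equiv> basis_vec n (X i)"

abbreviation yb :: "nat \<Rightarrow> nat \<Rightarrow> (gen \<Rightarrow> 'a::field)" where
  "yb n i \<equiv> basis_vec n (Y i)"

text \<open>The bilinear map on NF with the values \<open>t g h\<close> on pairs of basis elements.\<close>

definition bilinear_ext ::
    "nat \<Rightarrow> (gen \<Rightarrow> gen \<Rightarrow> (gen \<Rightarrow> 'a::field)) \<Rightarrow> (gen \<Rightarrow> 'a) \<Rightarrow> (gen \<Rightarrow> 'a) \<Rightarrow> (gen \<Rightarrow> 'a)" where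
  "bilinear_ext n t u v =
     (if u \<in> superspace_total (NF n) \<and> v \<in> superspace_total (NF n)
      then \<Sum>g\<in>gens n. \<Sum>h\<in>gens n. vscale (u g * v h) (t g h) else 0)"

text \<open>In all tables below the generator arguments range over \<^term>\<open>gens n\<close>, so \<open>i\<close> is in \<open>{1..n}\<close>.\<close>

fun NF_table :: "nat \<Rightarrow> gen \<Rightarrow> gen \<Rightarrow> (gen \<Rightarrow> 'a::field)" where
  "NF_table n (Y i) (Y l) = (if l = 1 then xb n i else 0)"
| "NF_table n (X i) (Y l) = (if l = 1 \<and> i < n then vscale (1/2) (yb n (i + 1)) else 0)"
| "NF_table n (Y i) (X l) = (if l = 1 \<and> i < n then yb n (i + 1) else 0)"
| "NF_table n (X i) (X l) = (if l = 1 \<and> i < n then xb n (i + 1) else 0)"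

definition NF_bracket :: "nat \<Rightarrow> (gen \<Rightarrow> 'a::field) \<Rightarrow> (gen \<Rightarrow> 'a) \<Rightarrow> (gen \<Rightarrow> 'a)" where
  "NF_bracket n = bilinear_ext n (NF_table n)"

abbreviation ZL0_2 :: "nat \<Rightarrow> ((gen \<Rightarrow> 'a::field) \<Rightarrow> (gen \<Rightarrow> 'a) \<Rightarrow> (gen \<Rightarrow> 'a)) set" where
  "ZL0_2 n \<equiv> even_2cocycles vscale (NF n) (NF_bracket n)"

definition map_scale ::
    "'a::field \<Rightarrow> ((gen \<Rightarrow> 'a) \<Rightarrow> (gen \<Rightarrow> 'a) \<Rightarrow> (gen \<Rightarrow> 'a)) \<Rightarrow>
     ((gen \<Rightarrow> 'a) \<Rightarrow> (gen \<Rightarrow> 'a) \<Rightarrow> (gen \<Rightarrow> 'a))" where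
  "map_scale c f = (\<lambda>u v. vscale c (f u v))"

lemma vector_space_vscale: "vector_space vscale"
  by unfold_locales (auto simp: vscale_def fun_eq_iff algebra_simps)

lemma vector_space_map_scale: "vector_space map_scale"
  by unfold_locales (auto simp: map_scale_def vscale_def fun_eq_iff algebra_simps)


section \<open>The families of cocycles\<close>

fun phi_table_11 :: "nat \<Rightarrow> gen \<Rightarrow> gen \<Rightarrow> (gen \<Rightarrow> 'a::field)" where
  "phi_table_11 n (Y i) (Y l) = (if i = 1 \<and> l = 1 then xb n 1 else 0)"
| "phi_table_11 n (X i) (X l) = (if l = 1 \<and> i < n then - xb n (i + 1) else 0)"
| "phi_table_11 n (Y i) (X l) = (if l = 1 \<and> 2 \<le> i \<and> i < n then - yb n (i + 1) else 0)"
| "phi_table_11 n (X i) (Y l) = 0"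

fun phi_table_j1 :: "nat \<Rightarrow> nat \<Rightarrow> gen \<Rightarrow> gen \<Rightarrow> (gen \<Rightarrow> 'a::field)" where
  "phi_table_j1 n j (Y i) (Y l) = (if i = j \<and> l = 1 then xb n 1 else 0)"
| "phi_table_j1 n j (X i) (X l) =
     (if i + 1 = j \<and> l = 1 then xb n 1 else if l = j \<and> i < n then - xb n (i + 1) else 0)"
| "phi_table_j1 n j (Y i) (X l) =
     (if i = j \<and> l = 1 then yb n 2 else if l = j \<and> i < n then - yb n (i + 1) else 0)"
| "phi_table_j1 n j (X i) (Y l) = 0"

fun phi_table_1k :: "nat \<Rightarrow> nat \<Rightarrow> gen \<Rightarrow> gen \<Rightarrow> (gen \<Rightarrow> 'a::field)" where
  "phi_table_1k n k (Y i) (Y l) = (if i = 1 \<and> l = 1 then xb n k else 0)"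
| "phi_table_1k n k (Y i) (X l) = (if i = 1 \<and> l = 1 then yb n (k + 1) else 0)"
| "phi_table_1k n k (X i) (X l) = 0"
| "phi_table_1k n k (X i) (Y l) = 0"

fun phi_table_jk :: "nat \<Rightarrow> nat \<Rightarrow> nat \<Rightarrow> gen \<Rightarrow> gen \<Rightarrow> (gen \<Rightarrow> 'a::field)" where
  "phi_table_jk n j k (Y i) (Y l) = (if i = j \<and> l = 1 then xb n k else 0)"
| "phi_table_jk n j k (X i) (X l) = (if i + 1 = j \<and> l = 1 then xb n k else 0)"
| "phi_table_jk n j k (Y i) (X l) = (if i = j \<and> l = 1 then yb n (k + 1) else 0)"
| "phi_table_jk n j k (X i) (Y l) = 0"

fun psi_table_j1 :: "nat \<Rightarrow> nat \<Rightarrow> gen \<Rightarrow> gen \<Rightarrow> (gen \<Rightarrow> 'a::field)" where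
  "psi_table_j1 n j (X i) (Y l) =
     (if i = j \<and> l = 1 then yb n 1 else if l = j + 1 \<and> i < n then - yb n (i + 1) else 0)"
| "psi_table_j1 n j (X i) (X l) =
     (if i = j \<and> l = 1 then vscale 2 (xb n 1)
      else if l = j + 1 \<and> i < n then vscale (- 2) (xb n (i + 1)) else 0)"
| "psi_table_j1 n j (Y i) (X l) =
     (if i = j \<and> l = 1 then vscale 2 (yb n 1)
      else if l = j + 1 \<and> i < n then vscale (- 2) (yb n (i + 1)) else 0)"
| "psi_table_j1 n j (Y i) (Y l) = (if l = j + 1 then vscale (- 2) (xb n i) else 0)"

fun psi_table_jk :: "nat \<Rightarrow> nat \<Rightarrow> nat \<Rightarrow> gen \<Rightarrow> gen \<Rightarrow> (gen \<Rightarrow> 'a::field)" where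
  "psi_table_jk n j k (X i) (Y l) = (if i = j \<and> l = 1 then yb n k else 0)"
| "psi_table_jk n j k (X i) (X l) = (if i = j \<and> l = 1 then vscale 2 (xb n k) else 0)"
| "psi_table_jk n j k (Y i) (X l) = (if i = j \<and> l = 1 then vscale 2 (yb n k) else 0)"
| "psi_table_jk n j k (Y i) (Y l) = 0"

datatype cocycle_index = Phi nat nat | Psi nat nat

definition cocycle_indices :: "nat \<Rightarrow> cocycle_index set" where
  "cocycle_indices n =
     {Phi j k | j k. j \<in> {1..n} \<and> k \<in> {1..n}} \<union>
     {Psi j k | j k. j \<in> {1..n} \<and> k \<in> {1..n} \<and> (j, k) \<noteq> (n, 1)}"

fun cocycle_table :: "nat \<Rightarrow> cocycle_index \<Rightarrow> gen \<Rightarrow> gen \<Rightarrow> (gen \<Rightarrow> 'a::field)" where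
  "cocycle_table n (Phi j k) =
     (if j = 1 \<and> k = 1 then phi_table_11 n
      else if k = 1 then phi_table_j1 n j
      else if j = 1 then phi_table_1k n k
      else phi_table_jk n j k)"
| "cocycle_table n (Psi j k) = (if k = 1 then psi_table_j1 n j else psi_table_jk n j k)"

definition cocycle ::
    "nat \<Rightarrow> cocycle_index \<Rightarrow> (gen \<Rightarrow> 'a::field) \<Rightarrow> (gen \<Rightarrow> 'a) \<Rightarrow> (gen \<Rightarrow> 'a)" where
  "cocycle n p = bilinear_ext n (cocycle_table n p)"

text \<open>An indexed family is a basis of \<open>W\<close>: it is injective, and its range is independent with span \<open>W\<close>.\<close>

definition family_basis ::
    "('a::field \<Rightarrow> 'w::ab_group_add \<Rightarrow> 'w) \<Rightarrow> 'i set \<Rightarrow> ('i \<Rightarrow> 'w) \<Rightarrow> 'w set \<Rightarrow> bool" where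
  "family_basis scale I f W \<longleftrightarrow>
     inj_on f I \<and> \<not> module.dependent scale (f ` I) \<and> module.span scale (f ` I) = W"

end

theory Submission
  imports Defs
begin

text \<open>
  A cocycle \<open>f\<close> is determined by \<open>f(\<cdot>, y\<^sub>1)\<close>, because \<open>x\<^sub>1 = [y\<^sub>1, y\<^sub>1]\<close>, \<open>x\<^sub>j\<^sub>+\<^sub>1 = [x\<^sub>j, x\<^sub>1]\<close> and
  \<open>y\<^sub>j\<^sub>+\<^sub>1 = [y\<^sub>j, x\<^sub>1]\<close>, so that the cocycle identity yields \<open>f(\<cdot>, x\<^sub>1)\<close>, then all \<open>f(\<cdot>, x\<^sub>j)\<close> and
  all \<open>f(\<cdot>, y\<^sub>j)\<close>. The coefficient of \<open>x\<^sub>k\<close> in \<open>f(y\<^sub>j, y\<^sub>1)\<close> and the coefficient of \<open>y\<^sub>k\<close> in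
  \<open>f(x\<^sub>j, y\<^sub>1)\<close> are functionals dual to the two families. The only coefficient not belonging to an
  index, that of \<open>y\<^sub>1\<close> in \<open>f(x\<^sub>n, y\<^sub>1)\<close>, vanishes as soon as all the others do.
\<close>

section \<open>Bases from dual functionals\<close>

text \<open>Applying \<open>\<alpha> p\<close> to a combination returns its coefficient at
  \<open>p\<close>, which gives independence. For spanning, subtracting from \<open>w\<close> the
  combination with coefficients \<open>\<alpha> q w\<close> leaves an element of \<open>W\<close>
  killed by every functional, so \<open>sep\<close> makes it zero.\<close>

lemma family_basisI_dual:
  fixes scale :: "'a::field \<Rightarrow> 'w::ab_group_add \<Rightarrow> 'w"
  assumes "vector_space scale" and fin: "finite I"
    and W: "module.subspace scale W"
    and fW: "\<And>p. p \<in> I \<Longrightarrow> f p \<in> W"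
    and add: "\<And>p u v. \<alpha> p (u + v) = \<alpha> p u + \<alpha> p v"
    and hom: "\<And>p c u. \<alpha> p (scale c u) = c * \<alpha> p u"
    and dual: "\<And>p q. p \<in> I \<Longrightarrow> q \<in> I \<Longrightarrow> \<alpha> p (f q) = (if p = q then 1 else 0)"
    and sep: "\<And>w. w \<in> W \<Longrightarrow> (\<And>p. p \<in> I \<Longrightarrow> \<alpha> p w = 0) \<Longrightarrow> w = 0"
  shows "family_basis scale I f W"
proof -
  interpret vector_space scale by fact
  have zero: "\<alpha> p 0 = 0" for p
    using hom[of p 0 0] by simp
  have sum: "\<alpha> p (sum g A) = (\<Sum>a\<in>A. \<alpha> p (g a))" for p A and g :: "'b \<Rightarrow> 'w"
    by (induction A rule: infinite_finite_induct) (auto simp: zero add)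
  have coord: "\<alpha> p (\<Sum>q\<in>I. scale (c q) (f q)) = c p" if "p \<in> I" for p c
  proof -
    have "\<alpha> p (\<Sum>q\<in>I. scale (c q) (f q)) = (\<Sum>q\<in>I. if q = p then c q else 0)"
      unfolding sum hom by (rule sum.cong) (auto simp: dual that)
    then show ?thesis using fin that by simp
  qed
  have inj: "inj_on f I"
  proof (rule inj_onI)
    fix p q assume "p \<in> I" "q \<in> I" "f p = f q"
    then show "p = q" using dual[of p p] dual[of p q] by (auto split: if_splits)
  qed
  have "\<not> dependent (f ` I)"
  proof
    assume "dependent (f ` I)"
    then obtain u v where uv: "v \<in> f ` I" "u v \<noteq> 0" "(\<Sum>v\<in>f ` I. scale (u v) v) = 0"
      using dependent_finite[of "f ` I"] fin by auto
    then obtain p where p: "p \<in> I" "v = f p" by auto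
    have "(\<Sum>q\<in>I. scale (u (f q)) (f q)) = 0"
      using uv(3) by (simp add: sum.reindex[OF inj])
    then have "u (f p) = 0"
      using coord[OF p(1), of "\<lambda>q. u (f q)"] zero by simp
    with uv p show False by simp
  qed
  moreover have "span (f ` I) = W"
  proof
    show "span (f ` I) \<subseteq> W"
      using fW W by (intro span_minimal) auto
    show "W \<subseteq> span (f ` I)"
    proof
      fix w assume w: "w \<in> W"
      define s where "s = (\<Sum>q\<in>I. scale (\<alpha> q w) (f q))"
      have s: "s \<in> span (f ` I)"
        unfolding s_def by (intro span_sum span_scale span_base) auto
      then have "s \<in> W" using \<open>span (f ` I) \<subseteq> W\<close> by auto
      then have "w - s \<in> W" using W w by (simp add: subspace_diff)
      \<comment> \<open>Additivity is applied to \<open>w = (w - s) + s\<close>, which determines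
        the value at the difference.\<close>
      moreover have "\<alpha> p (w - s) = 0" if "p \<in> I" for p
        using add[of p "w - s" s] coord[OF that, of "\<lambda>q. \<alpha> q w"] by (simp add: s_def)
      ultimately have "w - s = 0" by (rule sep)
      with s show "w \<in> span (f ` I)" by simp
    qed
  qed
  ultimately show ?thesis
    using inj by (simp add: family_basis_def)
qed

section \<open>The superspace NF and its coordinates\<close>

interpretation V: vector_space "vscale :: 'a::field \<Rightarrow> (gen \<Rightarrow> 'a) \<Rightarrow> gen \<Rightarrow> 'a"
  by (rule vector_space_vscale)

interpretation M: vector_space
  "map_scale :: 'a::field \<Rightarrow> ((gen \<Rightarrow> 'a) \<Rightarrow> (gen \<Rightarrow> 'a) \<Rightarrow> gen \<Rightarrow> 'a) \<Rightarrow> _"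
  by (rule vector_space_map_scale)

lemma gens_iff [simp]:
  "X i \<in> gens n \<longleftrightarrow> 1 \<le> i \<and> i \<le> n" "Y i \<in> gens n \<longleftrightarrow> 1 \<le> i \<and> i \<le> n"
  by (auto simp: gens_def)

lemma finite_gens [simp]: "finite (gens n)"
  by (simp add: gens_def)

lemma subspace_NF: "V.subspace (NF n a)"
proof (rule V.subspaceI)
  fix u v :: "gen \<Rightarrow> 'a" assume "u \<in> NF n a" "v \<in> NF n a"
  then have "g \<in> gens n \<and> parity g = a" if "(u + v) g \<noteq> 0" for g
    using that by (cases "u g = 0") (auto simp: NF_def)
  then show "u + v \<in> NF n a" by (simp add: NF_def)
qed (auto simp: NF_def vscale_def)

text \<open>Splitting a vector by the parity of the generators shows that the grading leaves no
  trace in the total space: only the support matters.\<close>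

lemma mem_total_NF:
  "v \<in> superspace_total (NF n) \<longleftrightarrow> (\<forall>g. g \<notin> gens n \<longrightarrow> v g = 0)"
proof
  assume "v \<in> superspace_total (NF n)"
  then obtain u w where "v = u + w" "u \<in> NF n 0" "w \<in> NF n 1"
    by (auto simp: superspace_total_def)
  then have "u g = 0" "w g = 0" if "g \<notin> gens n" for g
    using that by (auto simp: NF_def)
  with \<open>v = u + w\<close> show "\<forall>g. g \<notin> gens n \<longrightarrow> v g = 0" by simp
next
  assume v: "\<forall>g. g \<notin> gens n \<longrightarrow> v g = 0"
  let ?p = "\<lambda>a g. if parity g = a then v g else 0"
  have "parity g = 0 \<or> parity g = 1" for g by (cases g) auto
  then have "v = ?p 0 + ?p 1" by (fastforce simp: fun_eq_iff)
  moreover have "?p a \<in> NF n a" for a using v by (auto simp: NF_def)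
  ultimately show "v \<in> superspace_total (NF n)"
    unfolding superspace_total_def by blast
qed

lemma subspace_total_NF: "V.subspace (superspace_total (NF n))"
  by (rule V.subspaceI) (auto simp: mem_total_NF vscale_def)

lemmas total_NF_closed [simp, intro] =
  V.subspace_0[OF subspace_total_NF] V.subspace_add[OF subspace_total_NF]
  V.subspace_diff[OF subspace_total_NF] V.subspace_neg[OF subspace_total_NF]
  V.subspace_scale[OF subspace_total_NF]

lemmas NF_closed [simp, intro] =
  V.subspace_0[OF subspace_NF] V.subspace_add[OF subspace_NF]
  V.subspace_diff[OF subspace_NF] V.subspace_neg[OF subspace_NF]
  V.subspace_scale[OF subspace_NF]

lemma NF_subset_total: "v \<in> NF n a \<Longrightarrow> v \<in> superspace_total (NF n)"
  by (auto simp: NF_def mem_total_NF)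

lemma basis_vec_NF: "parity g = a \<Longrightarrow> basis_vec n g \<in> NF n a"
  by (auto simp: basis_vec_def NF_def)

lemma basis_vec_total [simp, intro]: "basis_vec n g \<in> superspace_total (NF n)"
  by (auto intro: NF_subset_total basis_vec_NF)

lemma basis_vec_eq_0: "g \<notin> gens n \<Longrightarrow> basis_vec n g = 0"
  by (auto simp: basis_vec_def fun_eq_iff)

lemma expand_in_basis:
  assumes "v \<in> superspace_total (NF n)"
  shows "v = (\<Sum>g\<in>gens n. vscale (v g) (basis_vec n g))"
proof
  fix h
  have "(\<Sum>g\<in>gens n. vscale (v g) (basis_vec n g)) h = (\<Sum>g\<in>gens n. vscale (v g) (basis_vec n g) h)"
    by (induction rule: finite_induct[OF finite_gens]) auto
  also have "\<dots> = (\<Sum>g\<in>gens n. if g = h then v g else 0)"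
    by (rule sum.cong) (auto simp: vscale_def basis_vec_def)
  also have "\<dots> = v h" using assms by (simp add: mem_total_NF)
  finally show "v h = (\<Sum>g\<in>gens n. vscale (v g) (basis_vec n g)) h" ..
qed

text \<open>\<open>S\<close> will be the total space or one homogeneous component. Testing only the
  basis vectors in the support of \<open>v\<close> keeps every partial sum of the expansion inside
  \<open>S\<close>.\<close>

lemma linear_eq_0:
  fixes F :: "(gen \<Rightarrow> 'a::field) \<Rightarrow> (gen \<Rightarrow> 'a)"
  assumes S: "V.subspace S"
    and add: "\<And>u v. u \<in> S \<Longrightarrow> v \<in> S \<Longrightarrow> F (u + v) = F u + F v"
    and hom: "\<And>c u. u \<in> S \<Longrightarrow> F (vscale c u) = vscale c (F u)"
    and basis: "\<And>g. v g \<noteq> 0 \<Longrightarrow> basis_vec n g \<in> S \<and> F (basis_vec n g) = 0"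
    and v: "v \<in> superspace_total (NF n)"
  shows "F v = 0"
proof -
  have S0: "0 \<in> S" using S by (rule V.subspace_0)
  then have F0: "F 0 = 0" using hom[of 0 0] by simp
  have summand: "vscale (v g) (basis_vec n g) \<in> S \<and> F (vscale (v g) (basis_vec n g)) = 0" for g
    using basis[of g] by (cases "v g = 0") (auto simp: S0 F0 hom V.subspace_scale[OF S])
  \<comment> \<open>Membership in \<open>S\<close> is carried through the induction because
    \<open>F\<close> is assumed additive only there.\<close>
  define P where "P A \<longleftrightarrow> (\<Sum>g\<in>A. vscale (v g) (basis_vec n g)) \<in> S \<and>
      F (\<Sum>g\<in>A. vscale (v g) (basis_vec n g)) = 0" for A
  have "P (gens n)"
    using finite_gens
  proof (induction rule: finite_induct)
    case empty
    show ?case by (simp add: P_def F0 S0)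
  next
    case (insert g A)
    then show ?case
      unfolding P_def sum.insert[OF insert.hyps] using summand[of g]
      by (simp add: add V.subspace_add[OF S])
  qed
  then show ?thesis
    using expand_in_basis[OF v] by (simp add: P_def)
qed

section \<open>Maps given by tables and even bilinear maps\<close>

lemma bilinear_ext_bilinear_on:
  "bilinear_on vscale (superspace_total (NF n)) (bilinear_ext n t)"
  by (simp add: bilinear_on_def bilinear_ext_def V.scale_sum_right sum.distrib[symmetric] 
       V.scale_left_distrib[symmetric] distrib_right distrib_left)
    (simp add: vscale_def mult_ac)

lemma bilinear_ext_basis:
  "bilinear_ext n t (basis_vec n g) (basis_vec n h) =
     (if g \<in> gens n \<and> h \<in> gens n then t g h else 0)"
proof -
  have "(\<Sum>g'\<in>gens n. \<Sum>h'\<in>gens n. vscale (basis_vec n g g' * basis_vec n h h') (t g' h')) =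
     (\<Sum>g'\<in>gens n. \<Sum>h'\<in>gens n. if h' = h then if g' = g then t g h else 0 else 0)"
    by (intro sum.cong) (auto simp: basis_vec_def)
  also have "\<dots> = (if g \<in> gens n \<and> h \<in> gens n then t g h else 0)"
    by (cases "h \<in> gens n") auto
  finally show ?thesis by (simp add: bilinear_ext_def)
qed

lemma bilinear_ext_NF:
  assumes "\<And>g h. g \<in> gens n \<Longrightarrow> h \<in> gens n \<Longrightarrow> t g h \<in> NF n (parity g + parity h)"
    and "u \<in> NF n a" "v \<in> NF n b"
  shows "bilinear_ext n t u v \<in> NF n (a + b)"
proof -
  have "vscale (u g * v h) (t g h) \<in> NF n (a + b)" if "g \<in> gens n" "h \<in> gens n" for g h
  \<comment> \<open>A surviving term has two nonzero coefficients, which forces the degrees of its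
    generators.\<close>
  proof (cases "u g = 0 \<or> v h = 0")
    case False
    then have "a = parity g" "b = parity h" using assms(2,3) by (auto simp: NF_def)
    then show ?thesis using assms(1)[OF that] by simp
  qed auto
  then show ?thesis
    by (auto simp: bilinear_ext_def intro!: V.subspace_sum[OF subspace_NF])
qed

text \<open>What the bracket shares with every cocycle, so that the calculation rules below serve
  both.\<close>

definition even_bilinear ::
    "nat \<Rightarrow> ((gen \<Rightarrow> 'a::field) \<Rightarrow> (gen \<Rightarrow> 'a) \<Rightarrow> (gen \<Rightarrow> 'a)) \<Rightarrow> bool" where
  "even_bilinear n f \<longleftrightarrow> bilinear_on vscale (superspace_total (NF n)) f \<and>
     (\<forall>a b. \<forall>u\<in>NF n a. \<forall>v\<in>NF n b. f u v \<in> NF n (a + b))"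

lemma even_bilinear_ext:
  assumes "\<And>g h. g \<in> gens n \<Longrightarrow> h \<in> gens n \<Longrightarrow> t g h \<in> NF n (parity g + parity h)"
  shows "even_bilinear n (bilinear_ext n t)"
  using bilinear_ext_NF[OF assms] bilinear_ext_bilinear_on by (auto simp: even_bilinear_def)

context
  fixes n :: nat and f :: "(gen \<Rightarrow> 'a::field) \<Rightarrow> (gen \<Rightarrow> 'a) \<Rightarrow> (gen \<Rightarrow> 'a)"
  assumes f: "even_bilinear n f"
begin

lemma bilinear_rules:
  assumes "u \<in> superspace_total (NF n)" "v \<in> superspace_total (NF n)"
  shows "w \<in> superspace_total (NF n) \<Longrightarrow> f (u + v) w = f u w + f v w"
    and "w \<in> superspace_total (NF n) \<Longrightarrow> f w (u + v) = f w u + f w v"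
    and "f (vscale c u) v = vscale c (f u v)"
    and "f u (vscale c v) = vscale c (f u v)"
  using f assms by (auto simp: even_bilinear_def bilinear_on_def)

lemma bilinear_zero:
  assumes "u \<in> superspace_total (NF n)"
  shows "f 0 u = 0" "f u 0 = 0"
  using bilinear_rules(3)[of 0 u 0] bilinear_rules(4)[of u 0 0] assms by auto

lemma even_bilinear_NF: "u \<in> NF n a \<Longrightarrow> v \<in> NF n b \<Longrightarrow> f u v \<in> NF n (a + b)"
  using f by (auto simp: even_bilinear_def)

lemma even_bilinear_total:
  assumes "u \<in> superspace_total (NF n)" "v \<in> superspace_total (NF n)"
  shows "f u v \<in> superspace_total (NF n)"
proof -
  \<comment> \<open>Evenness speaks of homogeneous arguments only, so both arguments are split
    first.\<close>
  obtain u0 u1 v0 v1 where "u = u0 + u1" "v = v0 + v1"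
    and mem: "u0 \<in> NF n 0" "u1 \<in> NF n 1" "v0 \<in> NF n 0" "v1 \<in> NF n 1"
    using assms unfolding superspace_total_def by blast
  moreover note mem[THEN NF_subset_total]
  moreover have "f w w' \<in> superspace_total (NF n)" if "w \<in> {u0, u1}" "w' \<in> {v0, v1}" for w w'
    using that mem by (blast intro: NF_subset_total[OF even_bilinear_NF])
  ultimately show ?thesis
    by (simp add: bilinear_rules)
qed

lemma even_bilinear_eq_0:
  assumes "\<And>g h. g \<in> gens n \<Longrightarrow> h \<in> gens n \<Longrightarrow> f (basis_vec n g) (basis_vec n h) = 0"
    and u: "u \<in> superspace_total (NF n)" and v: "v \<in> superspace_total (NF n)"
  shows "f u v = 0"
proof -
  have supp: "g \<in> gens n" if "w g \<noteq> 0" "w \<in> superspace_total (NF n)" for g and w :: "gen \<Rightarrow> 'a"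
    using that by (auto simp: mem_total_NF)
  have *: "f u (basis_vec n h) = 0" if "h \<in> gens n" for h
  proof (rule linear_eq_0[OF subspace_total_NF, where F = "\<lambda>w. f w (basis_vec n h)"])
    show "basis_vec n g \<in> superspace_total (NF n) \<and> f (basis_vec n g) (basis_vec n h) = 0"
      if "u g \<noteq> 0" for g
      using assms(1)[OF supp[OF that u] \<open>h \<in> gens n\<close>] by simp
  qed (use u in \<open>simp_all add: bilinear_rules\<close>)
  show ?thesis
  proof (rule linear_eq_0[OF subspace_total_NF, where F = "f u"])
    show "basis_vec n h \<in> superspace_total (NF n) \<and> f u (basis_vec n h) = 0"
      if "v h \<noteq> 0" for h
      using *[OF supp[OF that v]] by simp
  qed (use u v in \<open>simp_all add: bilinear_rules\<close>)
qed

end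

lemma even_bilinear_bracket: "even_bilinear n (NF_bracket n)"
  unfolding NF_bracket_def
proof (rule even_bilinear_ext)
  fix g h
  show "NF_table n g h \<in> NF n (parity g + parity h)"
    by (cases g; cases h) (auto intro!: basis_vec_NF)
qed

section \<open>The cocycle identity on basis triples\<close>

text \<open>The degrees of \<open>y\<close> and \<open>z\<close> are explicit arguments because a
  vector need not determine its degree: 0 lies in both components.\<close>

definition cocycle_defect ::
    "nat \<Rightarrow> ((gen \<Rightarrow> 'a::field) \<Rightarrow> (gen \<Rightarrow> 'a) \<Rightarrow> (gen \<Rightarrow> 'a)) \<Rightarrow> bit \<Rightarrow> bit \<Rightarrow>
     (gen \<Rightarrow> 'a) \<Rightarrow> (gen \<Rightarrow> 'a) \<Rightarrow> (gen \<Rightarrow> 'a) \<Rightarrow> (gen \<Rightarrow> 'a)" where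
  "cocycle_defect n f b c x y z =
     NF_bracket n x (f y z) - NF_bracket n (f x y) z + koszul b c (NF_bracket n (f x z) y)
     + f x (NF_bracket n y z) - f (NF_bracket n x y) z + koszul b c (f (NF_bracket n x z) y)"

lemma koszul_add: "koszul b c (u + v) = koszul b c u + koszul b c v"
  by (simp add: koszul_def)

lemma koszul_scale: "koszul b c (vscale r u) = vscale r (koszul b c u)"
  by (simp add: koszul_def)

lemma ZL_iff:
  "f \<in> ZL0_2 n \<longleftrightarrow>
     (\<forall>u v. u \<notin> superspace_total (NF n) \<or> v \<notin> superspace_total (NF n) \<longrightarrow> f u v = 0) \<and>
     even_bilinear n f \<and>
     (\<forall>a b c. \<forall>x\<in>NF n a. \<forall>y\<in>NF n b. \<forall>z\<in>NF n c. cocycle_defect n f b c x y z = 0)"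
  by (auto simp: even_2cocycles_def even_bilinear_def cocycle_defect_def)

text \<open>For fixed \<open>b\<close> and \<open>c\<close> the Koszul sign is constant, so the
  defect is linear in each argument. Basis vectors of the right degrees are replaced by arbitrary
  homogeneous vectors in \<open>x\<close>, then \<open>y\<close>, then \<open>z\<close>.\<close>

lemma cocycle_defect_eq_0I:
  assumes f: "even_bilinear n f"
    and basis: "\<And>g h k. g \<in> gens n \<Longrightarrow> h \<in> gens n \<Longrightarrow> k \<in> gens n \<Longrightarrow>
      cocycle_defect n f (parity h) (parity k) (basis_vec n g) (basis_vec n h) (basis_vec n k) = 0"
    and x: "x \<in> NF n a" and y: "y \<in> NF n b" and z: "z \<in> NF n c"
  shows "cocycle_defect n f b c x y z = 0"
proof -
  note rules = cocycle_defect_def bilinear_rules[OF f] bilinear_rules[OF even_bilinear_bracket]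
    koszul_add koszul_scale even_bilinear_total[OF f]
    even_bilinear_total[OF even_bilinear_bracket]
    V.scale_right_distrib V.scale_right_diff_distrib
  have supp: "g \<in> gens n" "parity g = a" if "v g \<noteq> 0" "v \<in> NF n a" for v :: "gen \<Rightarrow> 'a" and g a
    using that by (auto simp: NF_def)
  have X: "cocycle_defect n f b c x (basis_vec n h) (basis_vec n k) = 0"
    if "h \<in> gens n" "parity h = b" "k \<in> gens n" "parity k = c" for h k
  proof (rule linear_eq_0[OF subspace_NF[of n a] _ _ _ NF_subset_total[OF x]])
    note mem = basis_vec_NF[OF that(2), of n] basis_vec_NF[OF that(4), of n]
    show "cocycle_defect n f b c (u + v) (basis_vec n h) (basis_vec n k) =
        cocycle_defect n f b c u (basis_vec n h) (basis_vec n k) +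
        cocycle_defect n f b c v (basis_vec n h) (basis_vec n k)"
      if "u \<in> NF n a" "v \<in> NF n a" for u v
      using mem[THEN NF_subset_total] that[THEN NF_subset_total] by (simp add: rules)
    show "cocycle_defect n f b c (vscale r u) (basis_vec n h) (basis_vec n k) =
        vscale r (cocycle_defect n f b c u (basis_vec n h) (basis_vec n k))"
      if "u \<in> NF n a" for r u
      using mem[THEN NF_subset_total] that[THEN NF_subset_total] by (simp add: rules)
  qed (use supp[OF _ x] basis that in \<open>auto intro!: basis_vec_NF\<close>)
  have Y: "cocycle_defect n f b c x y (basis_vec n k) = 0"
    if "k \<in> gens n" "parity k = c" for k
  proof (rule linear_eq_0[OF subspace_NF[of n b] _ _ _ NF_subset_total[OF y]])
    note mem = x basis_vec_NF[OF that(2), of n]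
    show "cocycle_defect n f b c x (u + v) (basis_vec n k) =
        cocycle_defect n f b c x u (basis_vec n k) + cocycle_defect n f b c x v (basis_vec n k)"
      if "u \<in> NF n b" "v \<in> NF n b" for u v
      using mem[THEN NF_subset_total] that[THEN NF_subset_total] by (simp add: rules)
    show "cocycle_defect n f b c x (vscale r u) (basis_vec n k) =
        vscale r (cocycle_defect n f b c x u (basis_vec n k))"
      if "u \<in> NF n b" for r u
      using mem[THEN NF_subset_total] that[THEN NF_subset_total] by (simp add: rules)
  qed (use supp[OF _ y] X that in \<open>auto intro!: basis_vec_NF\<close>)
  show ?thesis
  proof (rule linear_eq_0[OF subspace_NF[of n c] _ _ _ NF_subset_total[OF z]])
    note mem = x y
    show "cocycle_defect n f b c x y (u + v) =
        cocycle_defect n f b c x y u + cocycle_defect n f b c x y v"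
      if "u \<in> NF n c" "v \<in> NF n c" for u v
      using mem[THEN NF_subset_total] that[THEN NF_subset_total] by (simp add: rules)
    show "cocycle_defect n f b c x y (vscale r u) = vscale r (cocycle_defect n f b c x y u)"
      if "u \<in> NF n c" for r u
      using mem[THEN NF_subset_total] that[THEN NF_subset_total] by (simp add: rules)
  qed (use supp[OF _ z] Y in \<open>auto intro!: basis_vec_NF\<close>)
qed

text \<open>At fixed arguments the defect is linear in \<open>f\<close>.\<close>

lemma subspace_ZL: "M.subspace (ZL0_2 n)"
proof (rule M.subspaceI)
  note br = bilinear_rules[OF even_bilinear_bracket] bilinear_zero[OF even_bilinear_bracket]
    even_bilinear_total[OF even_bilinear_bracket]
  show "0 \<in> ZL0_2 n"
    by (auto simp: ZL_iff even_bilinear_def bilinear_on_def cocycle_defect_def koszul_def br NF_subset_total)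
  fix f h :: "(gen \<Rightarrow> 'a) \<Rightarrow> (gen \<Rightarrow> 'a) \<Rightarrow> gen \<Rightarrow> 'a"
  assume f: "f \<in> ZL0_2 n" and h: "h \<in> ZL0_2 n"
  then have ef: "even_bilinear n f" and eh: "even_bilinear n h" by (auto simp: ZL_iff)
  have "cocycle_defect n (f + h) b c x y z =
      cocycle_defect n f b c x y z + cocycle_defect n h b c x y z"
    if "x \<in> NF n a" "y \<in> NF n b" "z \<in> NF n c" for a b c x y z
    using that[THEN NF_subset_total] by (simp add: cocycle_defect_def br koszul_add
        even_bilinear_total[OF ef] even_bilinear_total[OF eh])
  moreover have "even_bilinear n (f + h)"
    using ef eh by (auto simp: even_bilinear_def bilinear_on_def V.scale_right_distrib)
  ultimately show "f + h \<in> ZL0_2 n"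
    using f h by (auto simp: ZL_iff)
next
  note br = bilinear_rules[OF even_bilinear_bracket]
  fix r and f :: "(gen \<Rightarrow> 'a) \<Rightarrow> (gen \<Rightarrow> 'a) \<Rightarrow> gen \<Rightarrow> 'a"
  assume f: "f \<in> ZL0_2 n"
  then have ef: "even_bilinear n f" by (auto simp: ZL_iff)
  have "cocycle_defect n (map_scale r f) b c x y z = vscale r (cocycle_defect n f b c x y z)"
    if "x \<in> NF n a" "y \<in> NF n b" "z \<in> NF n c" for a b c x y z
    using that[THEN NF_subset_total] by (simp add: cocycle_defect_def map_scale_def br koszul_scale
        even_bilinear_total[OF ef] V.scale_right_distrib V.scale_right_diff_distrib)
  moreover have "even_bilinear n (map_scale r f)"
    using ef by (auto simp: even_bilinear_def bilinear_on_def map_scale_def V.scale_right_distrib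
        V.scale_left_commute)
  ultimately show "map_scale r f \<in> ZL0_2 n"
    using f by (auto simp: ZL_iff map_scale_def)
qed

section \<open>The listed maps are cocycles\<close>

text \<open>Table values are zero or scaled or negated basis vectors under conditionals; these rules
  evaluate a second map on such values.\<close>

lemma bilinear_ext_simps:
  fixes t :: "gen \<Rightarrow> gen \<Rightarrow> gen \<Rightarrow> 'a::field"
  shows "bilinear_ext n t (vscale c (basis_vec n g)) (basis_vec n h) =
        vscale c (bilinear_ext n t (basis_vec n g) (basis_vec n h))"
    "bilinear_ext n t (basis_vec n g) (vscale c (basis_vec n h)) =
        vscale c (bilinear_ext n t (basis_vec n g) (basis_vec n h))"
    "bilinear_ext n t (- basis_vec n g) (basis_vec n h) =
        - bilinear_ext n t (basis_vec n g) (basis_vec n h)"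
    "bilinear_ext n t (basis_vec n g) (- basis_vec n h) =
        - bilinear_ext n t (basis_vec n g) (basis_vec n h)"
    "bilinear_ext n t 0 (basis_vec n h) = 0"
    "bilinear_ext n t (basis_vec n g) 0 = 0"
    "bilinear_ext n t (if P then u else v) w =
      (if P then bilinear_ext n t u w else bilinear_ext n t v w)"
    "bilinear_ext n t w (if P then u else v) =
      (if P then bilinear_ext n t w u else bilinear_ext n t w v)"
proof -
  note B = bilinear_ext_bilinear_on[of n t, unfolded bilinear_on_def]
  show s: "bilinear_ext n t (vscale c (basis_vec n g)) (basis_vec n h) =
        vscale c (bilinear_ext n t (basis_vec n g) (basis_vec n h))"
    "bilinear_ext n t (basis_vec n g) (vscale c (basis_vec n h)) =
        vscale c (bilinear_ext n t (basis_vec n g) (basis_vec n h))" for c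
    using B by auto
  show "bilinear_ext n t 0 (basis_vec n h) = 0" "bilinear_ext n t (basis_vec n g) 0 = 0"
    using s[of 0] by simp_all
  show "bilinear_ext n t (- basis_vec n g) (basis_vec n h) =
        - bilinear_ext n t (basis_vec n g) (basis_vec n h)"
    "bilinear_ext n t (basis_vec n g) (- basis_vec n h) =
        - bilinear_ext n t (basis_vec n g) (basis_vec n h)"
    using s[of "-1"] by simp_all
qed auto

lemma basis_vec_apply: "basis_vec n g h = (if h = g \<and> g \<in> gens n then 1 else 0)"
  by (simp add: basis_vec_def)

lemma vscale_apply: "vscale c v g = c * v g"
  by (simp add: vscale_def)

lemma table_in_ZL:
  fixes t :: "gen \<Rightarrow> gen \<Rightarrow> gen \<Rightarrow> 'a::field"
  assumes "\<And>g h. g \<in> gens n \<Longrightarrow> h \<in> gens n \<Longrightarrow> t g h \<in> NF n (parity g + parity h)"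
    and "\<And>g h k. g \<in> gens n \<Longrightarrow> h \<in> gens n \<Longrightarrow> k \<in> gens n \<Longrightarrow>
      cocycle_defect n (bilinear_ext n t) (parity h) (parity k)
        (basis_vec n g) (basis_vec n h) (basis_vec n k) = 0"
  shows "bilinear_ext n t \<in> ZL0_2 n"
  unfolding ZL_iff using even_bilinear_ext[OF assms(1)]
  by (auto simp: bilinear_ext_def intro!: cocycle_defect_eq_0I assms(2))

text \<open>
  The set pushes \<open>if\<close> out of the arguments of bilinear maps, so it needs simplification inside the
  branches (\<open>if_weak_cong\<close> removed), and it evaluates \<open>vscale (- c) v\<close> but not \<open>- vscale c v\<close>
  (\<open>V.scale_minus_left\<close> removed).
\<close>

lemmas defect_simps =
  cocycle_defect_def koszul_def NF_bracket_def bilinear_ext_basis bilinear_ext_simps basis_vec_eq_0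

text \<open>The triple (g, y_1, y_1) forces f(g,x_1) = 2[f(g,y_1),y_1] + 2f([g,y_1],y_1) -
  [g,f(y_1,y_1)]. For f(y_1,y_1) = x_1 the last term produces the negative entries; at g = y_1 it
  cancels against 2[x_1,y_1] = y_2.\<close>

lemma phi_table_11_in_ZL: "bilinear_ext n (phi_table_11 n) \<in>
    (ZL0_2 n :: ((gen \<Rightarrow> 'a::field_char_0) \<Rightarrow> _) set)"
proof (rule table_in_ZL)
  fix g h m assume "g \<in> gens n" "h \<in> gens n"
  then show "phi_table_11 n g h \<in> NF n (parity g + parity h)"
    by (cases g; cases h) (auto intro!: basis_vec_NF NF_closed)
  assume "m \<in> gens n"
  with \<open>g \<in> gens n\<close> \<open>h \<in> gens n\<close>
  show "cocycle_defect n (bilinear_ext n (phi_table_11 n)) (parity h) (parity m)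
      (basis_vec n g) (basis_vec n h) (basis_vec n m) = (0 :: gen \<Rightarrow> 'a)"
    \<comment> \<open>In NF only right factors x_1 and y_1 give nonzero products, so asking whether
      \<open>h\<close> and \<open>m\<close> are among them settles which brackets survive. What
      remains is compared coordinatewise.\<close>
    by (cases "h \<in> {X 1, Y 1}"; cases "m \<in> {X 1, Y 1}"; cases g; cases h; cases m;
        simp add: defect_simps split del: if_split
          cong del: if_weak_cong del: V.scale_minus_left;
        (intro ext; simp add: vscale_apply basis_vec_eq_0))
qed

text \<open>The entry x_1 at (x_{j-1}, x_1) acts by right multiplication, so the triple (g, x_{j-1},
  x_1) forces f(g,x_j) = -[g,x_1]: this is the column of negative entries.\<close>

lemma phi_table_j1_in_ZL:
  assumes "2 \<le> j" "j \<le> n"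
  shows "bilinear_ext n (phi_table_j1 n j) \<in>
    (ZL0_2 n :: ((gen \<Rightarrow> 'a::field_char_0) \<Rightarrow> _) set)"
proof (rule table_in_ZL)
  fix g h m assume "g \<in> gens n" "h \<in> gens n"
  then show "phi_table_j1 n j g h \<in> NF n (parity g + parity h)"
    by (cases g; cases h) (auto intro!: basis_vec_NF NF_closed)
  assume "m \<in> gens n"
  with \<open>g \<in> gens n\<close> \<open>h \<in> gens n\<close>
  show "cocycle_defect n (bilinear_ext n (phi_table_j1 n j)) (parity h) (parity m)
      (basis_vec n g) (basis_vec n h) (basis_vec n m) = (0 :: gen \<Rightarrow> 'a)"
    using assms
    by (cases "h \<in> {X 1, Y 1}"; cases "m \<in> {X 1, Y 1}"; cases g; cases h; cases m;
        simp add: defect_simps numeral_2_eq_2 split del: if_split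
          cong del: if_weak_cong del: V.scale_minus_left;
        (intro ext; simp add: vscale_apply basis_vec_eq_0))
qed

text \<open>Since k is at least 2, right multiplication by x_k is zero, and the only further entry
  is 2[x_k,y_1] = y_{k+1}.\<close>

lemma phi_table_1k_in_ZL:
  assumes "2 \<le> k" "k \<le> n"
  shows "bilinear_ext n (phi_table_1k n k) \<in>
    (ZL0_2 n :: ((gen \<Rightarrow> 'a::field_char_0) \<Rightarrow> _) set)"
proof (rule table_in_ZL)
  fix g h m assume "g \<in> gens n" "h \<in> gens n"
  then show "phi_table_1k n k g h \<in> NF n (parity g + parity h)"
    by (cases g; cases h) (auto intro!: basis_vec_NF NF_closed)
  assume "m \<in> gens n"
  with \<open>g \<in> gens n\<close> \<open>h \<in> gens n\<close>
  show "cocycle_defect n (bilinear_ext n (phi_table_1k n k)) (parity h) (parity m)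
      (basis_vec n g) (basis_vec n h) (basis_vec n m) = (0 :: gen \<Rightarrow> 'a)"
    using assms
    by (cases "h \<in> {X 1, Y 1}"; cases "m \<in> {X 1, Y 1}"; cases g; cases h; cases m;
        simp add: defect_simps split del: if_split
          cong del: if_weak_cong del: V.scale_minus_left;
        (intro ext; simp add: vscale_apply basis_vec_eq_0))
qed

text \<open>The entry at (x_{j-1}, x_1) comes from [x_{j-1},y_1] = (1/2) y_j.\<close>

lemma phi_table_jk_in_ZL:
  assumes "2 \<le> j" "j \<le> n" "2 \<le> k" "k \<le> n"
  shows "bilinear_ext n (phi_table_jk n j k) \<in>
    (ZL0_2 n :: ((gen \<Rightarrow> 'a::field_char_0) \<Rightarrow> _) set)"
proof (rule table_in_ZL)
  fix g h m assume "g \<in> gens n" "h \<in> gens n"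
  then show "phi_table_jk n j k g h \<in> NF n (parity g + parity h)"
    by (cases g; cases h) (auto intro!: basis_vec_NF NF_closed)
  assume "m \<in> gens n"
  with \<open>g \<in> gens n\<close> \<open>h \<in> gens n\<close>
  show "cocycle_defect n (bilinear_ext n (phi_table_jk n j k)) (parity h) (parity m)
      (basis_vec n g) (basis_vec n h) (basis_vec n m) = (0 :: gen \<Rightarrow> 'a)"
    using assms
    by (cases "h \<in> {X 1, Y 1}"; cases "m \<in> {X 1, Y 1}"; cases g; cases h; cases m;
        simp add: defect_simps split del: if_split
          cong del: if_weak_cong del: V.scale_minus_left;
        (intro ext; simp add: vscale_apply basis_vec_eq_0))
qed

text \<open>The values 2x_1 at (x_j, x_1) and 2y_1 at (y_j, x_1) act by right multiplication, which
  forces f(g,x_{j+1}) = -2[g,x_1] and f(g,y_{j+1}) = -2[g,y_1]. With \<open>j < n\<close> the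
  generators carrying these corrections exist.\<close>

lemma psi_table_j1_in_ZL:
  assumes "1 \<le> j" "j < n"
  shows "bilinear_ext n (psi_table_j1 n j) \<in>
    (ZL0_2 n :: ((gen \<Rightarrow> 'a::field_char_0) \<Rightarrow> _) set)"
proof (rule table_in_ZL)
  fix g h m assume "g \<in> gens n" "h \<in> gens n"
  then show "psi_table_j1 n j g h \<in> NF n (parity g + parity h)"
    by (cases g; cases h) (auto intro!: basis_vec_NF NF_closed)
  assume "m \<in> gens n"
  with \<open>g \<in> gens n\<close> \<open>h \<in> gens n\<close>
  show "cocycle_defect n (bilinear_ext n (psi_table_j1 n j)) (parity h) (parity m)
      (basis_vec n g) (basis_vec n h) (basis_vec n m) = (0 :: gen \<Rightarrow> 'a)"
    using assms
    by (cases "h \<in> {X 1, Y 1}"; cases "m \<in> {X 1, Y 1}"; cases g; cases h; cases m;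
        simp add: defect_simps split del: if_split
          cong del: if_weak_cong del: V.scale_minus_left;
        (intro ext; simp add: vscale_apply basis_vec_eq_0))
qed

text \<open>The factors 2 come from 2[y_k,y_1] = 2x_k and 2f([y_j,y_1],y_1) = 2f(x_j,y_1); for k at
  least 2 no further columns are forced.\<close>

lemma psi_table_jk_in_ZL:
  assumes "1 \<le> j" "j \<le> n" "2 \<le> k" "k \<le> n"
  shows "bilinear_ext n (psi_table_jk n j k) \<in>
    (ZL0_2 n :: ((gen \<Rightarrow> 'a::field_char_0) \<Rightarrow> _) set)"
proof (rule table_in_ZL)
  fix g h m assume "g \<in> gens n" "h \<in> gens n"
  then show "psi_table_jk n j k g h \<in> NF n (parity g + parity h)"
    by (cases g; cases h) (auto intro!: basis_vec_NF NF_closed)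
  assume "m \<in> gens n"
  with \<open>g \<in> gens n\<close> \<open>h \<in> gens n\<close>
  show "cocycle_defect n (bilinear_ext n (psi_table_jk n j k)) (parity h) (parity m)
      (basis_vec n g) (basis_vec n h) (basis_vec n m) = (0 :: gen \<Rightarrow> 'a)"
    using assms
    by (cases "h \<in> {X 1, Y 1}"; cases "m \<in> {X 1, Y 1}"; cases g; cases h; cases m;
        simp add: defect_simps split del: if_split
          cong del: if_weak_cong del: V.scale_minus_left;
        (intro ext; simp add: vscale_apply basis_vec_eq_0))
qed

lemma cocycle_in_ZL:
  assumes "p \<in> cocycle_indices n"
  shows "cocycle n p \<in> (ZL0_2 n :: ((gen \<Rightarrow> 'a::field_char_0) \<Rightarrow> _) set)"
proof (cases p)
  case (Phi j k)
  with assms have "1 \<le> j" "j \<le> n" "1 \<le> k" "k \<le> n" by (auto simp: cocycle_indices_def)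
  then show ?thesis
    by (auto simp: Phi cocycle_def phi_table_11_in_ZL intro!: phi_table_j1_in_ZL
        phi_table_1k_in_ZL phi_table_jk_in_ZL)
next
  case (Psi j k)
  with assms have "1 \<le> j" "j \<le> n" "1 \<le> k" "k \<le> n" "k = 1 \<Longrightarrow> j \<noteq> n"
    by (auto simp: cocycle_indices_def)
  then show ?thesis
    by (auto simp: Psi cocycle_def intro!: psi_table_j1_in_ZL psi_table_jk_in_ZL)
qed

section \<open>Dual coordinates\<close>

fun coord :: "nat \<Rightarrow> cocycle_index \<Rightarrow> ((gen \<Rightarrow> 'a::field) \<Rightarrow> (gen \<Rightarrow> 'a) \<Rightarrow> (gen \<Rightarrow> 'a)) \<Rightarrow> 'a" where
  "coord n (Phi j k) f = f (yb n j) (yb n 1) (X k)"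
| "coord n (Psi j k) f = f (xb n j) (yb n 1) (Y k)"

text \<open>In the column y_1 each table has exactly one nonzero entry, a basis vector; the
  correction columns have index at least 2.\<close>

lemma coord_cocycle:
  assumes "p \<in> cocycle_indices n" "q \<in> cocycle_indices n"
  shows "coord n p (cocycle n q) = (if p = q then 1 else 0)"
  using assms
  by (cases p; cases q; simp add: cocycle_indices_def cocycle_def bilinear_ext_basis;
      auto simp: basis_vec_def vscale_def)

lemma finite_cocycle_indices: "finite (cocycle_indices n)"
proof (rule finite_subset)
  show "cocycle_indices n \<subseteq> case_prod Phi ` ({1..n} \<times> {1..n}) \<union> case_prod Psi ` ({1..n} \<times> {1..n})"
    by (auto simp: cocycle_indices_def)
qed simp

section \<open>Cocycles with vanishing coordinates\<close>

lemma bracket_basis: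
  "NF_bracket n (basis_vec n g) (basis_vec n h) =
     (if g \<in> gens n \<and> h \<in> gens n then NF_table n g h else 0)"
  by (simp add: NF_bracket_def bilinear_ext_basis)

lemma NF_eq_single:
  assumes "v \<in> NF n a" "\<And>g. g \<noteq> h \<Longrightarrow> g \<in> gens n \<Longrightarrow> parity g = a \<Longrightarrow> v g = 0" "h \<in> gens n"
  shows "v = vscale (v h) (basis_vec n h)"
proof
  fix g
  show "v g = vscale (v h) (basis_vec n h) g"
    using assms by (cases "g = h") (auto simp: NF_def vscale_def basis_vec_def)
qed

lemma cocycle_eq_0:
  fixes f :: "(gen \<Rightarrow> 'a::field_char_0) \<Rightarrow> (gen \<Rightarrow> 'a) \<Rightarrow> (gen \<Rightarrow> 'a)"
  assumes n: "n \<ge> 1" and f: "f \<in> ZL0_2 n"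
    and coord: "\<And>p. p \<in> cocycle_indices n \<Longrightarrow> coord n p f = 0"
  shows "f = 0"
proof -
  have ef: "even_bilinear n f" using f by (simp add: ZL_iff)
  \<comment> \<open>Instantiation follows the order \<open>h\<close>, \<open>k\<close>,
    \<open>g\<close>: second, third, then first argument.\<close>
  have defect: "cocycle_defect n f (parity h) (parity k)
      (basis_vec n g) (basis_vec n h) (basis_vec n k) = 0" for g h k
  proof -
    have "\<forall>x\<in>NF n a. \<forall>y\<in>NF n b. \<forall>z\<in>NF n c. cocycle_defect n f b c x y z = 0" for a b c
      using f by (simp add: ZL_iff)
    then show ?thesis using basis_vec_NF[OF refl] by blast
  qed
  define c where "c = f (xb n n) (yb n 1) (Y 1)"
  note br = bilinear_rules(3,4)[OF even_bilinear_bracket] bilinear_zero[OF even_bilinear_bracket]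
    bracket_basis bilinear_rules(3,4)[OF ef] bilinear_zero[OF ef] basis_vec_eq_0
  have NFf: "f (basis_vec n g) (basis_vec n h) \<in> NF n (parity g + parity h)" for g h
    by (rule even_bilinear_NF[OF ef basis_vec_NF basis_vec_NF]) auto
  \<comment> \<open>Even coordinates vanish by the \<open>Phi\<close> coordinates, odd ones by
    parity.\<close>
  have yy: "f (yb n j) (yb n 1) = 0" if "1 \<le> j" "j \<le> n" for j
  proof
    fix g
    show "f (yb n j) (yb n 1) g = 0 g"
      using NFf[of "Y j" "Y 1"] coord[of "Phi j _"] that
      by (cases g) (fastforce simp: NF_def cocycle_indices_def)+
  qed
  have xy: "f (xb n j) (yb n 1) = 0" if "1 \<le> j" "j < n" for j
  proof
    fix g
    show "f (xb n j) (yb n 1) g = 0 g"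
      using NFf[of "X j" "Y 1"] coord[of "Psi j _"] that
      by (cases g) (fastforce simp: NF_def cocycle_indices_def)+
  qed
  \<comment> \<open>For j = n the indices start at k = 2, so the coefficient \<open>c\<close> of y_1
    survives.\<close>
  have ny: "f (xb n n) (yb n 1) = vscale c (yb n 1)"
    unfolding c_def
  proof (rule NF_eq_single)
    show "f (xb n n) (yb n 1) \<in> NF n 1" using NFf[of "X n" "Y 1"] by simp
    show "f (xb n n) (yb n 1) g = 0" if "g \<noteq> Y 1" "g \<in> gens n" "parity g = 1" for g
      using that n coord[of "Psi n _"] by (cases g) (auto simp: cocycle_indices_def)
  qed (use n in simp)
  \<comment> \<open>Two odd arguments y_1 give the sign -1, so the swapped terms double instead of
    cancelling, while [y_1,y_1] = x_1 isolates the left side.\<close>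
  have gx: "f (basis_vec n g) (xb n 1) =
      vscale 2 (f (NF_bracket n (basis_vec n g) (yb n 1)) (yb n 1)) +
      vscale 2 (NF_bracket n (f (basis_vec n g) (yb n 1)) (yb n 1))" if "g \<in> gens n" for g
  proof
    fix x
    show "f (basis_vec n g) (xb n 1) x =
      (vscale 2 (f (NF_bracket n (basis_vec n g) (yb n 1)) (yb n 1)) +
      vscale 2 (NF_bracket n (f (basis_vec n g) (yb n 1)) (yb n 1))) x"
      using fun_cong[OF defect[of "Y 1" "Y 1" g], of x] that yy[of 1] n
      by (simp add: cocycle_defect_def koszul_def br vscale_apply algebra_simps)
  qed
  have xx: "f (xb n j) (xb n 1) = (if j = n then vscale (2 * c) (xb n 1) else 0)" if "1 \<le> j" "j \<le> n" for j
    using that gx[of "X j"] yy[of "Suc j"] xy[of j] ny n by (auto simp: br)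
  have yx: "f (yb n j) (xb n 1) = (if j = n then vscale (2 * c) (yb n 1) else 0)" if "1 \<le> j" "j \<le> n" for j
    using that gx[of "Y j"] yy[of j] xy[of j] ny n by (auto simp: br)
  note x1 = xx[unfolded One_nat_def] yx[unfolded One_nat_def]
  \<comment> \<open>This column vanishes before \<open>c\<close> is known to be 0: only f(x_i,x_1)
    with i < n enters as an inner value, and those are already zero.\<close>
  have R: "f (basis_vec n g) (xb n j) = 0" if "2 \<le> j" "j \<le> n" "g \<in> gens n" for j g
    using that
  proof (induction j arbitrary: g rule: nat_induct_at_least)
    case base
    \<comment> \<open>With y = z = x_1 even, the swapped terms cancel, leaving [g,f(x_1,x_1)] +
      f(g,x_2).\<close>
    then have "f (basis_vec n g) (xb n 2) = 0"
      using defect[of "X 1" "X 1" g] xx[of 1]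
      by (simp add: cocycle_defect_def koszul_def br numeral_2_eq_2)
    then show ?case .
  next
    case (Suc j)
    have IH: "f (basis_vec n h) (xb n j) = 0" if "h \<in> gens n" for h
      by (rule Suc.IH) (use Suc.prems that in auto)
    have "f (NF_bracket n (basis_vec n g) (xb n 1)) (xb n j) = 0"
      using Suc.prems IH by (cases g) (auto simp: br)
    \<comment> \<open>Whatever f(g,x_1) is, right multiplication by x_j is zero for j at least
      2.\<close>
    moreover have "NF_bracket n (f (basis_vec n g) (xb n 1)) (xb n j) = 0"
      using Suc.hyps Suc.prems by (cases g) (auto simp: br x1)
    ultimately have "f (basis_vec n g) (xb n (Suc j)) = 0"
      using defect[of "X j" "X 1" g] Suc.hyps Suc.prems IH[of g]
      by (cases g) (simp_all add: cocycle_defect_def koszul_def br x1)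
    then show ?case .
  qed
  have "c = 0"
  proof (cases "n = 1")
    case True
    then show ?thesis
      \<comment> \<open>The triple (y_1, x_1, y_1) gives c - 2c + 2c = 0 at x_1.\<close>
      using fun_cong[OF defect[of "X 1" "Y 1" "Y 1"], of "X 1"] yy[of 1] ny yx[of 1] xx[of 1]
      by (simp add: cocycle_defect_def koszul_def br vscale_apply basis_vec_apply)
  next
    case False
    with n have "2 \<le> n" by simp
    then show ?thesis
      \<comment> \<open>In the triple (y_n, x_n, y_1) only [y_n, c y_1] = c x_n remains.\<close>
      using fun_cong[OF defect[of "X n" "Y 1" "Y n"], of "X n"] yy[of n] ny R[of n]
      by (simp add: cocycle_defect_def koszul_def br vscale_apply basis_vec_apply)
  qed
  have x: "f (basis_vec n g) (xb n j) = 0" if "1 \<le> j" "j \<le> n" "g \<in> gens n" for j g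
    using that R[of j g] \<open>c = 0\<close> by (cases "j = 1"; cases g) (auto simp: x1)
  have y: "f (basis_vec n g) (yb n j) = 0" if "1 \<le> j" "j \<le> n" "g \<in> gens n" for j g
    using that
  proof (induction j arbitrary: g rule: nat_induct_at_least)
    case base
    have "f (basis_vec n g) (yb n 1) = 0"
    proof (cases g)
      case (X i)
      then show ?thesis using base xy[of i] ny \<open>c = 0\<close> by (cases "i = n") auto
    next
      case (Y i)
      then show ?thesis using base yy[of i] by simp
    qed
    then show ?case .
  next
    case (Suc j)
    have IH: "f (basis_vec n h) (yb n j) = 0" if "h \<in> gens n" for h
      by (rule Suc.IH) (use Suc.prems that in auto)
    have "f (NF_bracket n (basis_vec n g) (xb n 1)) (yb n j) = 0"
      using Suc.prems IH by (cases g) (auto simp: br)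
    moreover have "f (NF_bracket n (basis_vec n g) (yb n j)) (xb n 1) = 0"
      using Suc.prems x n by (cases g) (auto simp: br)
    \<comment> \<open>The triple (g, y_j, x_1) isolates f(g,y_{j+1}) through [y_j,x_1] =
      y_{j+1}.\<close>
    ultimately have "f (basis_vec n g) (yb n (Suc j)) = 0"
      using defect[of "Y j" "X 1" g] Suc.hyps Suc.prems IH[of g] n
      by (simp add: cocycle_defect_def koszul_def br x)
    then show ?case .
  qed
  have zero: "f (basis_vec n g) (basis_vec n h) = 0" if "g \<in> gens n" "h \<in> gens n" for g h
    using that x y by (cases h) auto
  show ?thesis
  proof (intro ext)
    fix u v g
    have "f u v = 0" if "u \<notin> superspace_total (NF n) \<or> v \<notin> superspace_total (NF n)"
      using that f by (simp add: ZL_iff)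
    then have "f u v = 0"
      using even_bilinear_eq_0[OF ef zero, of u v] by blast
    then show "f u v g = 0 u v g" by simp
  qed
qed

theorem theorem4p4:
  fixes n :: nat
  assumes "n \<ge> 1"
  shows "family_basis map_scale (cocycle_indices n) (cocycle n)
           (ZL0_2 n :: ((gen \<Rightarrow> 'a::field_char_0) \<Rightarrow> (gen \<Rightarrow> 'a) \<Rightarrow> (gen \<Rightarrow> 'a)) set)"
proof (rule family_basisI_dual[where \<alpha> = "coord n"])
  show "coord n p (u + v) = coord n p u + coord n p v"
    for p and u v :: "(gen \<Rightarrow> 'a) \<Rightarrow> (gen \<Rightarrow> 'a) \<Rightarrow> (gen \<Rightarrow> 'a)"
    by (cases p) auto
  show "coord n p (map_scale c u) = c * coord n p u"
    for p c and u :: "(gen \<Rightarrow> 'a) \<Rightarrow> (gen \<Rightarrow> 'a) \<Rightarrow> (gen \<Rightarrow> 'a)"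
    by (cases p) (auto simp: map_scale_def vscale_apply)
qed (use assms in \<open>auto intro: vector_space_map_scale finite_cocycle_indices subspace_ZL
    cocycle_in_ZL cocycle_eq_0[OF assms] simp: coord_cocycle\<close>)

end
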